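(* Let $F\subset\mathrm{Sym}^2(\mathbb R^n)$ be a subequation, and let $\psi:(a,b)\to[-\infty,\infty)$ be upper semi-continuous, where $(a,b)\subset(0,\infty)$. The function $u(x)=\psi(|x|)$ is $F$-subharmonic on the annular region $\{x\in\mathbb R^n:a<|x|<b\}$ if and only if $\psi(t)$ is $R_F$-subharmonic on $(a,b)$.
   Context: $\mathrm{Sym}^2(\mathbb R^n)$ is the space of real symmetric $n\times n$ matrices and $\mathcal P=\{A: A\ge 0\}$. A subequation is a closed subset $F\subset \mathrm{Sym}^2(\mathbb R^n)$ with $F+\mathcal P\subset F$ (here $F$ need not be a cone). For a unit vector $e\in\mathbb R^n$, $P_e$ and $P_{e^\perp}=I-P_e$ are the orthogonal projections onto the line $\mathbb Re$ and the hyperplane $e^\perp$. An upper semi-continuous $u:X\to[-\infty,\infty)$ on an open set $X\subset\mathbb R^n$ is $F$-subharmonic if whenever $x_0\in X$ and $\varphi$ is $C^2$ near $x_0$ with $u\le\varphi$ near $x_0$ and $u(x_0)=\varphi(x_0)$, one has $D^2\varphi(x_0)\in F$. The radial subequation $R_F$ on $(0,\infty)$ has fibre at $t>0$ $$(R_F)_t=\Bigl\{(\lambda,a)\in\mathbb R^2:\ \tfrac{\lambda}{t}P_{e^\perp}+aP_e\in F\ \text{ for all unit vectors } e\Bigr\}.$$ An upper semi-continuous $\psi:(a,b)\to[-\infty,\infty)$ is $R_F$-subharmonic if whenever $t_0\in(a,b)$ and $\varphi$ is $C^2$ near $t_0$ with $\psi\le\varphi$ near $t_0$ and $\psi(t_0)=\varphi(t_0)$,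 one has $(\varphi'(t_0),\varphi''(t_0))\in(R_F)_{t_0}$. *)

theory Defs
  imports "HOL-Analysis.Analysis"
begin

definition Sym2 :: "(real^'n^'n) set" where
  "Sym2 = {A. transpose A = A}"

definition psd :: "(real^'n^'n) set" where
  "psd = {A \<in> Sym2. \<forall>v. 0 \<le> v \<bullet> (A *v v)}"

definition subequation :: "(real^'n^'n) set \<Rightarrow> bool" where
  "subequation F \<longleftrightarrow>
     closedin (top_of_set Sym2) F \<and> (\<forall>A\<in>F. \<forall>P\<in>psd. A + P \<in> F)"

text \<open>For a unit vector \<open>e\<close>, the orthogonal projections onto the line through \<open>e\<close> and onto the
  hyperplane orthogonal to \<open>e\<close>.\<close>

definition proj_line :: "real^'n \<Rightarrow> real^'n^'n" where
  "proj_line e = matrix (\<lambda>x. (x \<bullet> e) *\<^sub>R e)"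

definition proj_perp :: "real^'n \<Rightarrow> real^'n^'n" where
  "proj_perp e = mat 1 - proj_line e"

text \<open>\<open>grad\<close> and \<open>hessian\<close> are only meaningful where the function is (twice) differentiable; below
  they are used for functions that are \<open>C\<^sup>2\<close> near the point in question.\<close>

definition grad :: "(real^'n \<Rightarrow> real) \<Rightarrow> real^'n \<Rightarrow> real^'n" where
  "grad f x = (\<chi> i. frechet_derivative f (at x) (axis i 1))"

definition hessian :: "(real^'n \<Rightarrow> real) \<Rightarrow> real^'n \<Rightarrow> real^'n^'n" where
  "hessian f x = jacobian (grad f) (at x)"

definition C2_near :: "(real^'n \<Rightarrow> real) \<Rightarrow> real^'n \<Rightarrow> bool" where
  "C2_near f x0 \<longleftrightarrow> (\<exists>U. open U \<and> x0 \<in> U \<and> f differentiable_on U \<and>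
     grad f differentiable_on U \<and> continuous_on U (hessian f))"

definition C2_near_real :: "(real \<Rightarrow> real) \<Rightarrow> real \<Rightarrow> bool" where
  "C2_near_real f t0 \<longleftrightarrow> (\<exists>U. open U \<and> t0 \<in> U \<and> f differentiable_on U \<and>
     deriv f differentiable_on U \<and> continuous_on U (deriv (deriv f)))"

text \<open>Upper semi-continuous functions \<open>X \<rightarrow> [-\<infinity>, \<infinity>)\<close> are modelled by total \<open>ereal\<close>-valued functions;
  their values outside \<open>X\<close> are irrelevant.\<close>

definition usc_on :: "'a::topological_space set \<Rightarrow> ('a \<Rightarrow> ereal) \<Rightarrow> bool" where
  "usc_on X u \<longleftrightarrow> (\<forall>x\<in>X. u x < \<infinity>) \<and>
     (\<forall>x\<in>X. \<forall>c. u x < c \<longrightarrow> (\<forall>\<^sub>F y in at x within X. u y < c))"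

definition subharmonic ::
    "(real^'n^'n) set \<Rightarrow> (real^'n) set \<Rightarrow> (real^'n \<Rightarrow> ereal) \<Rightarrow> bool" where
  "subharmonic F X u \<longleftrightarrow> open X \<and> usc_on X u \<and>
     (\<forall>x0\<in>X. \<forall>\<phi>. C2_near \<phi> x0 \<and> (\<forall>\<^sub>F x in nhds x0. u x \<le> ereal (\<phi> x)) \<and> u x0 = ereal (\<phi> x0)
        \<longrightarrow> hessian \<phi> x0 \<in> F)"

definition radial_subequation :: "(real^'n^'n) set \<Rightarrow> real \<Rightarrow> (real \<times> real) set" where
  "radial_subequation F t =
     {(l, a). \<forall>e. norm e = 1 \<longrightarrow> (l / t) *\<^sub>R proj_perp e + a *\<^sub>R proj_line e \<in> F}"

definition radial_subharmonic ::
    "(real^'n^'n) set \<Rightarrow> real set \<Rightarrow> (real \<Rightarrow> ereal) \<Rightarrow> bool" where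
  "radial_subharmonic F I \<psi> \<longleftrightarrow> open I \<and> usc_on I \<psi> \<and>
     (\<forall>t0\<in>I. \<forall>\<phi>. C2_near_real \<phi> t0 \<and> (\<forall>\<^sub>F t in nhds t0. \<psi> t \<le> ereal (\<phi> t)) \<and> \<psi> t0 = ereal (\<phi> t0)
        \<longrightarrow> (deriv \<phi> t0, deriv (deriv \<phi>) t0) \<in> radial_subequation F t0)"

end

theory Submission
  imports Defs
begin

text \<open>
  A radial test function \<open>g (norm x)\<close> has at \<open>t\<^sub>0 e\<close> the block-diagonal Hessian
  \<open>(g'/t\<^sub>0) P\<^sub>\<bottom> + g'' P\<^sub>e\<close>, which is the matrix occurring in the radial subequation
  (\<open>C2_radial\<close>). Testing \<open>\<psi> (norm x)\<close> only with radial functions therefore tests \<open>\<psi>\<close> itself, and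
  one implication follows at once.

  For the other implication let \<open>\<phi>\<close> touch \<open>\<psi> (norm x)\<close> from above at \<open>t\<^sub>0 e\<close>, with Hessian \<open>H\<close> and
  radial derivative \<open>l\<close> there. Since \<open>\<psi> (norm x)\<close> is constant on the sphere of radius \<open>t\<^sub>0\<close>, \<open>\<phi>\<close> has
  a minimum on that sphere at \<open>t\<^sub>0 e\<close>: the gradient is radial, and on tangent vectors \<open>H\<close> is at least
  \<open>l/t\<^sub>0\<close> (\<open>C2_min_on_sphere\<close>). Restricting \<open>\<phi>\<close> to the ray through \<open>e\<close> gives a test function for \<open>\<psi>\<close>,
  but it sees only the entry \<open>e \<bullet> H e\<close>, and the entries of \<open>H\<close> that mix \<open>e\<close> with tangent directions
  may prevent \<open>H\<close> from dominating \<open>(l/t\<^sub>0) P\<^sub>\<bottom> + (e \<bullet> H e) P\<^sub>e\<close>. So the ray is replaced by spirals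
  \<open>c\<close> with \<open>norm (c t) = t\<close> and arbitrary velocity \<open>y\<close>, \<open>y \<bullet> e = 1\<close>. Each one gives a test function
  for \<open>\<psi>\<close> with first derivative \<open>l\<close> and second derivative
  \<open>k y = y \<bullet> H y - (l/t\<^sub>0) (norm y\<^sup>2 - 1)\<close> (\<open>radial_test_function_from_spiral\<close>), hence
  \<open>(l/t\<^sub>0) P\<^sub>\<bottom> + k y P\<^sub>e\<close> lies in \<open>F\<close>. If finite, the infimum of \<open>k\<close> is the Schur complement that makes
  \<open>H - (l/t\<^sub>0) P\<^sub>\<bottom> - (inf k) P\<^sub>e\<close> positive semidefinite. After adding a small multiple of the identity to
  ensure that the infimum is finite and to absorb the error of an almost minimal \<open>y\<close>, positivity and
  closedness of \<open>F\<close> give \<open>H \<in> F\<close> (\<open>in_subequation_if_slices\<close>).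

  Adding a matrix of \<open>psd\<close> requires symmetry, so the argument also uses that the Hessian of a \<open>C\<^sup>2\<close>
  function is symmetric (\<open>second_derivative_symmetric\<close>).
\<close>

section \<open>Derivatives along curves and symmetry of the Hessian\<close>

lemma has_real_derivative_along:
  assumes c: "(c has_vector_derivative c') (at t)"
    and f: "(f has_derivative (\<lambda>h. g \<bullet> h)) (at (c t))"
  shows "((\<lambda>t. f (c t)) has_real_derivative g \<bullet> c') (at t)"
  using has_derivative_compose[OF c[unfolded has_vector_derivative_def] f]
  unfolding has_field_derivative_def by (rule has_derivative_eq_rhs) auto

lemma has_vector_derivative_along:
  fixes G :: "real^'n \<Rightarrow> real^'m"
  assumes c: "(c has_vector_derivative c') (at t)"
    and G: "(G has_derivative (\<lambda>h. M *v h)) (at (c t))"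
  shows "((\<lambda>t. G (c t)) has_vector_derivative M *v c') (at t)"
  using has_derivative_compose[OF c[unfolded has_vector_derivative_def] G]
  by (simp add: has_vector_derivative_def matrix_vector_mult_scaleR)

lemma has_real_derivative_inner:
  fixes c d :: "real \<Rightarrow> 'a::real_inner"
  assumes "(c has_vector_derivative c') (at t)" "(d has_vector_derivative d') (at t)"
  shows "((\<lambda>t. c t \<bullet> d t) has_real_derivative c' \<bullet> d t + c t \<bullet> d') (at t)"
  using has_derivative_inner[OF assms[unfolded has_vector_derivative_def]]
  unfolding has_field_derivative_def by (rule has_derivative_eq_rhs) (auto simp: algebra_simps)

text \<open>Apply the mean value theorem first in the direction \<open>u\<close> and then in the direction \<open>v\<close>. Applying
  them in the other order expresses the same difference through the other mixed derivative.\<close>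

lemma mixed_difference_mean_value:
  fixes f :: "real^'n \<Rightarrow> real"
  assumes s: "0 < s"
    and f: "\<And>a b. 0 \<le> a \<Longrightarrow> a \<le> s \<Longrightarrow> 0 \<le> b \<Longrightarrow> b \<le> s \<Longrightarrow>
      (f has_derivative (\<lambda>h. G (x + a *\<^sub>R u + b *\<^sub>R v) \<bullet> h)) (at (x + a *\<^sub>R u + b *\<^sub>R v))"
    and G: "\<And>a b. 0 \<le> a \<Longrightarrow> a \<le> s \<Longrightarrow> 0 \<le> b \<Longrightarrow> b \<le> s \<Longrightarrow>
      (G has_derivative (\<lambda>h. H (x + a *\<^sub>R u + b *\<^sub>R v) *v h)) (at (x + a *\<^sub>R u + b *\<^sub>R v))"
  shows "\<exists>a b. 0 < a \<and> a < s \<and> 0 < b \<and> b < s \<and>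
    f (x + s *\<^sub>R u + s *\<^sub>R v) - f (x + s *\<^sub>R u) - f (x + s *\<^sub>R v) + f x
      = s * s * ((H (x + a *\<^sub>R u + b *\<^sub>R v) *v v) \<bullet> u)"
proof -
  have df: "((\<lambda>a. f (x + a *\<^sub>R u + b *\<^sub>R v)) has_real_derivative G (x + a *\<^sub>R u + b *\<^sub>R v) \<bullet> u) (at a)"
    if "0 \<le> a" "a \<le> s" "0 \<le> b" "b \<le> s" for a b
    by (rule has_real_derivative_along[where c = "\<lambda>a. x + a *\<^sub>R u + b *\<^sub>R v", OF _ f[OF that]])
      (auto intro!: derivative_eq_intros)
  have dG: "((\<lambda>b. G (x + a *\<^sub>R u + b *\<^sub>R v) \<bullet> u) has_real_derivative
      (H (x + a *\<^sub>R u + b *\<^sub>R v) *v v) \<bullet> u) (at b)"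
    if "0 \<le> a" "a \<le> s" "0 \<le> b" "b \<le> s" for a b
  proof -
    have c: "((\<lambda>b. x + a *\<^sub>R u + b *\<^sub>R v) has_vector_derivative v) (at b)"
      by (auto intro!: derivative_eq_intros)
    show ?thesis
      using has_real_derivative_inner[OF has_vector_derivative_along[
          where c = "\<lambda>b. x + a *\<^sub>R u + b *\<^sub>R v", OF c G[OF that]], of "\<lambda>_. u" 0]
      by simp
  qed
  define g where "g a = f (x + a *\<^sub>R u + s *\<^sub>R v) - f (x + a *\<^sub>R u + 0 *\<^sub>R v)" for a
  have "\<exists>a. 0 < a \<and> a < s \<and>
      g s - g 0 = (s - 0) * (G (x + a *\<^sub>R u + s *\<^sub>R v) \<bullet> u - G (x + a *\<^sub>R u + 0 *\<^sub>R v) \<bullet> u)"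
    unfolding g_def by (rule MVT2[OF s]) (use s in \<open>intro DERIV_diff df; simp\<close>)
  then obtain a where a: "0 < a" "a < s"
    and 1: "g s - g 0 = (s - 0) * (G (x + a *\<^sub>R u + s *\<^sub>R v) \<bullet> u - G (x + a *\<^sub>R u + 0 *\<^sub>R v) \<bullet> u)"
    by blast
  have "\<exists>b. 0 < b \<and> b < s \<and>
      G (x + a *\<^sub>R u + s *\<^sub>R v) \<bullet> u - G (x + a *\<^sub>R u + 0 *\<^sub>R v) \<bullet> u
      = (s - 0) * ((H (x + a *\<^sub>R u + b *\<^sub>R v) *v v) \<bullet> u)"
    by (rule MVT2[OF s]) (use a in \<open>intro dG; simp\<close>)
  then obtain b where b: "0 < b" "b < s"
    and 2: "G (x + a *\<^sub>R u + s *\<^sub>R v) \<bullet> u - G (x + a *\<^sub>R u + 0 *\<^sub>R v) \<bullet> u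
      = (s - 0) * ((H (x + a *\<^sub>R u + b *\<^sub>R v) *v v) \<bullet> u)"
    by blast
  show ?thesis
    by (intro exI[of _ a] exI[of _ b] conjI a b) (use 1 2 in \<open>simp add: g_def algebra_simps\<close>)
qed

text \<open>The mixed difference over the parallelogram with sides \<open>s u\<close> and \<open>s v\<close>, divided by \<open>s\<^sup>2\<close>, is a value
  near \<open>x\<close> of either one of the two mixed derivatives; as \<open>s\<close> tends to zero, continuity makes them
  agree at \<open>x\<close>.\<close>

lemma second_derivative_symmetric:
  fixes f :: "real^'n \<Rightarrow> real"
  assumes U: "open U" "x \<in> U"
    and f: "\<And>y. y \<in> U \<Longrightarrow> (f has_derivative (\<lambda>h. G y \<bullet> h)) (at y)"
    and G: "\<And>y. y \<in> U \<Longrightarrow> (G has_derivative (\<lambda>h. H y *v h)) (at y)"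
    and H: "continuous_on U H"
  shows "(H x *v u) \<bullet> v = (H x *v v) \<bullet> u"
proof (rule ccontr)
  define q where "q u v y = (H y *v v) \<bullet> u" for u v y
  have qcont: "isCont (q u v) x" for u v
  proof -
    have "(H \<longlongrightarrow> H x) (at x)"
      using H U by (auto simp: continuous_on_eq_continuous_at isCont_def)
    then show ?thesis
      unfolding q_def isCont_def matrix_vector_mult_def by (intro tendsto_intros)
  qed
  assume "(H x *v u) \<bullet> v \<noteq> (H x *v v) \<bullet> u"
  then have e: "0 < \<bar>q u v x - q v u x\<bar> / 2" (is "0 < ?e")
    by (simp add: q_def)
  obtain r1 where r1: "0 < r1" "\<And>y. dist y x < r1 \<Longrightarrow> \<bar>q u v y - q u v x\<bar> < ?e"
    using qcont[of u v] e unfolding continuous_at_eps_delta dist_real_def by blast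
  obtain r2 where r2: "0 < r2" "\<And>y. dist y x < r2 \<Longrightarrow> \<bar>q v u y - q v u x\<bar> < ?e"
    using qcont[of v u] e unfolding continuous_at_eps_delta dist_real_def by (metis abs_minus_commute)
  obtain r3 where r3: "0 < r3" "ball x r3 \<subseteq> U"
    using U open_contains_ball by blast
  define r where "r = min r1 (min r2 r3)"
  have r: "0 < r" using r1 r2 r3 by (simp add: r_def)
  define s where "s = r / (norm u + norm v + 1)"
  have s: "0 < s" using r by (auto simp: s_def add_nonneg_pos)
  have near: "dist (x + a *\<^sub>R u' + b *\<^sub>R v') x < r"
    if "0 \<le> a" "a \<le> s" "0 \<le> b" "b \<le> s" "(u' = u \<and> v' = v) \<or> (u' = v \<and> v' = u)" for a b u' v'
  proof -
    have "dist (x + a *\<^sub>R u' + b *\<^sub>R v') x \<le> a * norm u' + b * norm v'"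
      using that norm_triangle_ineq[of "a *\<^sub>R u'" "b *\<^sub>R v'"] by (simp add: dist_norm)
    also have "\<dots> \<le> s * norm u' + s * norm v'"
      using that by (intro add_mono mult_right_mono) auto
    also have "\<dots> < s * (norm u + norm v + 1)"
      using that s by (auto simp: algebra_simps)
    also have "\<dots> = r"
      unfolding s_def using norm_ge_zero[of u] norm_ge_zero[of v]
      by (subst nonzero_eq_divide_eq[symmetric]) (auto simp: add_nonneg_eq_0_iff)
    finally show ?thesis .
  qed
  have nearU: "y \<in> U" if "dist y x < r" for y
    using that r3 by (auto simp: r_def dist_commute)
  have mean: "\<exists>a b. 0 < a \<and> a < s \<and> 0 < b \<and> b < s \<and>
      f (x + s *\<^sub>R u' + s *\<^sub>R v') - f (x + s *\<^sub>R u') - f (x + s *\<^sub>R v') + f x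
        = s * s * q u' v' (x + a *\<^sub>R u' + b *\<^sub>R v')"
    if uv: "(u' = u \<and> v' = v) \<or> (u' = v \<and> v' = u)" for u' v'
    unfolding q_def
  proof (rule mixed_difference_mean_value[OF s])
    fix a b assume "0 \<le> a" "a \<le> s" "0 \<le> b" "b \<le> s"
    then have y: "x + a *\<^sub>R u' + b *\<^sub>R v' \<in> U"
      using near uv nearU by simp
    show "(f has_derivative (\<lambda>h. G (x + a *\<^sub>R u' + b *\<^sub>R v') \<bullet> h)) (at (x + a *\<^sub>R u' + b *\<^sub>R v'))"
      by (rule f[OF y])
    show "(G has_derivative (\<lambda>h. H (x + a *\<^sub>R u' + b *\<^sub>R v') *v h)) (at (x + a *\<^sub>R u' + b *\<^sub>R v'))"
      by (rule G[OF y])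
  qed
  obtain a b where ab: "0 < a" "a < s" "0 < b" "b < s"
    "f (x + s *\<^sub>R u + s *\<^sub>R v) - f (x + s *\<^sub>R u) - f (x + s *\<^sub>R v) + f x
      = s * s * q u v (x + a *\<^sub>R u + b *\<^sub>R v)"
    using mean[of u v] by auto
  obtain a' b' where ab': "0 < a'" "a' < s" "0 < b'" "b' < s"
    "f (x + s *\<^sub>R v + s *\<^sub>R u) - f (x + s *\<^sub>R v) - f (x + s *\<^sub>R u) + f x
      = s * s * q v u (x + a' *\<^sub>R v + b' *\<^sub>R u)"
    using mean[of v u] by auto
  have "s * s * q u v (x + a *\<^sub>R u + b *\<^sub>R v) = s * s * q v u (x + a' *\<^sub>R v + b' *\<^sub>R u)"
    using ab(5) ab'(5) by (simp add: algebra_simps)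
  then have eq: "q u v (x + a *\<^sub>R u + b *\<^sub>R v) = q v u (x + a' *\<^sub>R v + b' *\<^sub>R u)"
    using s by simp
  have "\<bar>q u v (x + a *\<^sub>R u + b *\<^sub>R v) - q u v x\<bar> < ?e"
    using r1 near[of a b u v] ab by (auto simp: r_def)
  moreover have "\<bar>q v u (x + a' *\<^sub>R v + b' *\<^sub>R u) - q v u x\<bar> < ?e"
    using r2 near[of a' b' v u] ab' by (auto simp: r_def)
  ultimately have "\<bar>q u v (x + a *\<^sub>R u + b *\<^sub>R v) - q u v x\<bar>
      + \<bar>q v u (x + a' *\<^sub>R v + b' *\<^sub>R u) - q v u x\<bar> < \<bar>q u v x - q v u x\<bar>"
    by (metis add_strict_mono field_sum_of_halves)
  then show False unfolding eq by linarith
qed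

section \<open>Twice continuously differentiable functions\<close>

lemma grad_eqI:
  assumes "(f has_derivative (\<lambda>h. g \<bullet> h)) (at x)"
  shows "grad f x = g"
proof -
  have "frechet_derivative f (at x) = (\<lambda>h. g \<bullet> h)"
    using frechet_derivative_at[OF assms] by simp
  then show ?thesis by (simp add: grad_def vec_eq_iff inner_axis)
qed

lemma has_derivative_grad:
  assumes "f differentiable (at x)"
  shows "(f has_derivative (\<lambda>h. grad f x \<bullet> h)) (at x)"
proof -
  let ?D = "frechet_derivative f (at x)"
  have D: "(f has_derivative ?D) (at x)"
    using assms by (simp add: frechet_derivative_works)
  then have lin: "linear ?D" by (rule has_derivative_linear)
  have "?D h = grad f x \<bullet> h" for h
  proof -
    have "?D h = ?D (\<Sum>i\<in>UNIV. h $ i *\<^sub>R axis i 1)"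
      by (simp add: basis_expansion flip: scalar_mult_eq_scaleR)
    also have "\<dots> = (\<Sum>i\<in>UNIV. h $ i * ?D (axis i 1))"
      using lin by (simp add: linear_sum linear_cmul)
    finally show ?thesis by (simp add: grad_def inner_vec_def mult.commute)
  qed
  with D show ?thesis by (metis ext)
qed

lemma C2_nearE:
  assumes "C2_near f x0"
  obtains U where "open U" "x0 \<in> U"
    "\<And>x. x \<in> U \<Longrightarrow> (f has_derivative (\<lambda>h. grad f x \<bullet> h)) (at x)"
    "\<And>x. x \<in> U \<Longrightarrow> (grad f has_derivative (\<lambda>h. hessian f x *v h)) (at x)"
    "continuous_on U (hessian f)"
proof -
  obtain U where U: "open U" "x0 \<in> U" "f differentiable_on U" "grad f differentiable_on U"
      "continuous_on U (hessian f)"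
    using assms unfolding C2_near_def by blast
  show ?thesis
  proof (rule that[OF U(1,2) _ _ U(5)])
    fix x assume "x \<in> U"
    then have "f differentiable (at x)" "grad f differentiable (at x)"
      using U(1,3,4) unfolding differentiable_on_def by (metis at_within_open)+
    then show "(f has_derivative (\<lambda>h. grad f x \<bullet> h)) (at x)"
      "(grad f has_derivative (\<lambda>h. hessian f x *v h)) (at x)"
      unfolding hessian_def by (simp_all only: has_derivative_grad jacobian_works)
  qed
qed

lemma C2_near_real_E:
  assumes "C2_near_real f t0"
  obtains U where "open U" "t0 \<in> U"
    "\<And>t. t \<in> U \<Longrightarrow> (f has_real_derivative deriv f t) (at t)"
    "\<And>t. t \<in> U \<Longrightarrow> (deriv f has_real_derivative deriv (deriv f) t) (at t)"
    "continuous_on U (deriv (deriv f))"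
proof -
  obtain U where U: "open U" "t0 \<in> U" "f differentiable_on U" "deriv f differentiable_on U"
      "continuous_on U (deriv (deriv f))"
    using assms unfolding C2_near_real_def by blast
  show ?thesis
  proof (rule that[OF U(1,2) _ _ U(5)])
    fix x assume "x \<in> U"
    then have "f differentiable (at x)" "deriv f differentiable (at x)"
      using U(1,3,4) unfolding differentiable_on_def by (metis at_within_open)+
    then show "(f has_real_derivative deriv f x) (at x)"
      "(deriv f has_real_derivative deriv (deriv f) x) (at x)"
      by (simp_all only: DERIV_deriv_iff_real_differentiable)
  qed
qed

lemma C2_nearI:
  assumes U: "open U" "x0 \<in> U"
    and f: "\<And>x. x \<in> U \<Longrightarrow> (f has_derivative (\<lambda>h. G x \<bullet> h)) (at x)"
    and G: "\<And>x. x \<in> U \<Longrightarrow> (G has_derivative (\<lambda>h. H x *v h)) (at x)"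
    and H: "continuous_on U H"
  shows "C2_near f x0" "hessian f x0 = H x0"
proof -
  have g: "grad f x = G x" if "x \<in> U" for x using grad_eqI f that by blast
  have dg: "(grad f has_derivative (\<lambda>h. H x *v h)) (at x)" if "x \<in> U" for x
    using has_derivative_transform_within_open[OF G[OF that] U(1) that] g by metis
  have h: "hessian f x = H x" if "x \<in> U" for x
  proof -
    have "frechet_derivative (grad f) (at x) = (\<lambda>h. H x *v h)"
      using frechet_derivative_at[OF dg[OF that]] by simp
    then show ?thesis by (simp add: hessian_def jacobian_def)
  qed
  show "hessian f x0 = H x0" using h U by blast
  have "continuous_on U (hessian f)" using H h continuous_on_cong by metis
  then show "C2_near f x0"
    unfolding C2_near_def
    using U f dg by (meson differentiable_at_imp_differentiable_on differentiableI)
qed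

lemma C2_near_realI:
  assumes U: "open U" "t0 \<in> U"
    and f: "\<And>t. t \<in> U \<Longrightarrow> (f has_real_derivative g t) (at t)"
    and g: "\<And>t. t \<in> U \<Longrightarrow> (g has_real_derivative k t) (at t)"
    and k: "continuous_on U k"
  shows "C2_near_real f t0" "deriv f t0 = g t0" "deriv (deriv f) t0 = k t0"
proof -
  have d: "deriv f t = g t" if "t \<in> U" for t using DERIV_imp_deriv f that by blast
  have dd: "(deriv f has_real_derivative k t) (at t)" if "t \<in> U" for t
    using has_field_derivative_transform_within_open[OF g[OF that] U(1) that] d by metis
  have e: "deriv (deriv f) t = k t" if "t \<in> U" for t using DERIV_imp_deriv dd that by blast
  show "deriv f t0 = g t0" "deriv (deriv f) t0 = k t0" using d e U by blast+
  have "continuous_on U (deriv (deriv f))" using k e continuous_on_cong by metis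
  then show "C2_near_real f t0"
    unfolding C2_near_real_def
    using U f dd has_field_derivative_imp_has_derivative
    by (meson differentiable_at_imp_differentiable_on differentiableI)
qed

lemma hessian_in_Sym2:
  assumes "C2_near f x"
  shows "hessian f x \<in> Sym2"
proof -
  obtain U where U: "open U" "x \<in> U"
    "\<And>x. x \<in> U \<Longrightarrow> (f has_derivative (\<lambda>h. grad f x \<bullet> h)) (at x)"
    "\<And>x. x \<in> U \<Longrightarrow> (grad f has_derivative (\<lambda>h. hessian f x *v h)) (at x)"
    "continuous_on U (hessian f)"
    using C2_nearE[OF assms] by blast
  have "hessian f x $ i $ j = hessian f x $ j $ i" for i j
    using second_derivative_symmetric[OF U, of "axis j 1" "axis i 1"]
    by (simp add: inner_axis matrix_vector_mult_basis column_def)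
  then have "transpose (hessian f x) = hessian f x"
    unfolding transpose_def vec_eq_iff vec_lambda_beta by blast
  then show ?thesis unfolding Sym2_def by blast
qed

section \<open>Symmetric matrices and subequations\<close>

lemma proj_line_component: "proj_line e $ i $ j = e $ i * e $ j"
  by (simp add: proj_line_def matrix_def inner_axis' mult.commute)

lemma proj_line_mult: "proj_line e *v x = (x \<bullet> e) *\<^sub>R e"
  by (simp add: matrix_vector_mult_def proj_line_component vec_eq_iff inner_vec_def sum_distrib_left
      mult_ac)

lemma proj_perp_mult: "proj_perp e *v x = x - (x \<bullet> e) *\<^sub>R e"
  by (simp add: proj_perp_def matrix_vector_mult_diff_rdistrib proj_line_mult)

lemma Sym2_iff: "A \<in> Sym2 \<longleftrightarrow> (\<forall>i j. A $ i $ j = A $ j $ i)"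
  unfolding Sym2_def transpose_def vec_eq_iff vec_lambda_beta mem_Collect_eq by blast

lemma Sym2_mat [simp]: "mat c \<in> Sym2"
  unfolding Sym2_iff by (auto simp: mat_def)

lemma Sym2_proj_line [simp]: "proj_line e \<in> Sym2"
  unfolding Sym2_iff proj_line_component by simp

lemma Sym2_add: "A \<in> Sym2 \<Longrightarrow> B \<in> Sym2 \<Longrightarrow> A + B \<in> Sym2"
  unfolding Sym2_iff vector_add_component by metis

lemma Sym2_diff: "A \<in> Sym2 \<Longrightarrow> B \<in> Sym2 \<Longrightarrow> A - B \<in> Sym2"
  unfolding Sym2_iff vector_minus_component by metis

lemma Sym2_scaleR: "A \<in> Sym2 \<Longrightarrow> c *\<^sub>R A \<in> Sym2"
  unfolding Sym2_iff vector_scaleR_component by metis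

lemma Sym2_proj_perp [simp]: "proj_perp e \<in> Sym2"
  unfolding proj_perp_def by (intro Sym2_diff) simp_all

lemma Sym2_inner_commute:
  assumes "A \<in> Sym2"
  shows "x \<bullet> (A *v y) = y \<bullet> (A *v x)"
proof -
  have "transpose A = A" using assms by (simp add: Sym2_def)
  then have "x v* A = A *v x" using transpose_matrix_vector[of A x] by simp
  then show ?thesis using dot_lmul_matrix[of x A y] by (simp add: inner_commute)
qed

lemma subequation_limit:
  assumes F: "subequation F" and H: "H \<in> Sym2"
    and approx: "\<And>\<epsilon>. 0 < \<epsilon> \<Longrightarrow> H + \<epsilon> *\<^sub>R mat 1 \<in> F"
  shows "H \<in> F"
proof -
  obtain C where C: "closed C" "F = Sym2 \<inter> C"
    using F unfolding subequation_def closedin_closed by blast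
  have "((\<lambda>\<epsilon>. H + \<epsilon> *\<^sub>R mat 1) \<longlongrightarrow> H + 0 *\<^sub>R mat 1) (at_right (0::real))"
    by (intro tendsto_intros)
  moreover have "\<forall>\<^sub>F \<epsilon> in at_right (0::real). H + \<epsilon> *\<^sub>R mat 1 \<in> C"
    using approx C(2) by (auto simp: eventually_at_filter)
  ultimately have "H + 0 *\<^sub>R mat 1 \<in> C"
    by (intro Lim_in_closed_set[OF C(1)]) auto
  with H C show ?thesis by simp
qed

text \<open>In block form with respect to \<open>e\<close> and its orthogonal complement, the obstruction to
  \<open>H \<ge> \<mu> P\<^sub>\<bottom> + \<kappa> P\<^sub>e\<close> lies in the off-diagonal block. Minimising the form of \<open>H - \<mu> P\<^sub>\<bottom>\<close> over the
  affine hyperplane \<open>y \<bullet> e = 1\<close> is completing the square: if \<open>\<kappa>\<close> is the infimum, homogeneity gives the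
  inequality for every \<open>z\<close> with \<open>z \<bullet> e \<noteq> 0\<close>, and the tangential bound gives it for \<open>z \<bullet> e = 0\<close>.
  Where the tangential block degenerates the infimum can be \<open>-\<infinity>\<close>; adding \<open>\<epsilon>\<close> times the identity
  makes that block positive definite.\<close>

lemma in_subequation_if_slices:
  fixes F :: "(real^'n^'n) set"
  assumes F: "subequation F" and H: "H \<in> Sym2" and e: "norm e = 1"
    and tangential: "\<And>z. z \<bullet> e = 0 \<Longrightarrow> \<mu> * (norm z)\<^sup>2 \<le> z \<bullet> (H *v z)"
    and slice: "\<And>y. y \<bullet> e = 1 \<Longrightarrow>
      \<mu> *\<^sub>R proj_perp e + (y \<bullet> (H *v y) - \<mu> * ((norm y)\<^sup>2 - 1)) *\<^sub>R proj_line e \<in> F"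
  shows "H \<in> F"
proof (rule subequation_limit[OF F H])
  fix \<epsilon>2 :: real assume "0 < \<epsilon>2"
  \<comment> \<open>One half keeps the quadratic form bounded below, the other pays for an inexact minimiser.\<close>
  define \<epsilon> where "\<epsilon> = \<epsilon>2 / 2"
  have \<epsilon>: "0 < \<epsilon>" "\<epsilon>2 = 2 * \<epsilon>" using \<open>0 < \<epsilon>2\<close> by (auto simp: \<epsilon>_def)
  have ee: "e \<bullet> e = 1" using e by (simp add: norm_eq_1)
  define Q where "Q z = z \<bullet> (H *v z) - \<mu> * ((norm z)\<^sup>2 - (z \<bullet> e)\<^sup>2) + \<epsilon> * (norm z)\<^sup>2" for z
  define S where "S = Q ` {y. y \<bullet> e = 1}"
  define h where "h = norm (H *v e)"
  \<comment> \<open>Cauchy--Schwarz bounds the mixed term, and the square \<open>(\<epsilon> norm \<tau> - h)\<^sup>2\<close> absorbs it.\<close>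
  have "e \<bullet> (H *v e) - h\<^sup>2 / \<epsilon> \<le> Q y" if y: "y \<bullet> e = 1" for y
  proof -
    define \<tau> where "\<tau> = y - e"
    have \<tau>: "\<tau> \<bullet> e = 0" "e \<bullet> \<tau> = 0" and ye: "y = e + \<tau>"
      using y ee by (auto simp: \<tau>_def inner_diff_left inner_diff_right inner_commute)
    have ny: "(norm y)\<^sup>2 = 1 + (norm \<tau>)\<^sup>2"
      using ee \<tau> by (simp add: ye power2_norm_eq_inner inner_add_left inner_add_right)
    have "Q y = e \<bullet> (H *v e) + 2 * (\<tau> \<bullet> (H *v e)) + (\<tau> \<bullet> (H *v \<tau>) - \<mu> * (norm \<tau>)\<^sup>2) + \<epsilon> * (1 + (norm \<tau>)\<^sup>2)"
      using y ny Sym2_inner_commute[OF H, of e \<tau>] unfolding Q_def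
      by (simp add: ye inner_add_left inner_add_right matrix_vector_right_distrib)
    moreover have "- (norm \<tau> * h) \<le> \<tau> \<bullet> (H *v e)"
      using Cauchy_Schwarz_ineq2[of \<tau> "H *v e"] by (simp add: h_def abs_le_iff)
    moreover have "\<mu> * (norm \<tau>)\<^sup>2 \<le> \<tau> \<bullet> (H *v \<tau>)" by (rule tangential[OF \<tau>(1)])
    moreover have "- (h\<^sup>2 / \<epsilon>) \<le> \<epsilon> * (norm \<tau>)\<^sup>2 - 2 * (norm \<tau> * h)"
    proof -
      have "0 \<le> (\<epsilon> * norm \<tau> - h)\<^sup>2 / \<epsilon>" using \<epsilon> by simp
      also have "\<dots> = \<epsilon> * (norm \<tau>)\<^sup>2 - 2 * (norm \<tau> * h) + h\<^sup>2 / \<epsilon>"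
        using \<epsilon> by (simp add: power2_eq_square field_simps)
      finally show ?thesis by simp
    qed
    ultimately show ?thesis using \<epsilon>(1) by (simp add: distrib_left)
  qed
  then have bdd: "bdd_below S" unfolding S_def by (intro bdd_belowI2) auto
  have "S \<noteq> {}" using ee by (auto simp: S_def)
  then obtain y where y: "y \<bullet> e = 1" "Q y < Inf S + \<epsilon>"
    using cInf_lessD[of S "Inf S + \<epsilon>"] \<epsilon> by (auto simp: S_def)
  define \<kappa> where "\<kappa> = y \<bullet> (H *v y) - \<mu> * ((norm y)\<^sup>2 - 1)"
  have "\<kappa> \<le> Q y" using y \<epsilon> by (simp add: \<kappa>_def Q_def)
  with y have \<kappa>: "\<kappa> \<le> Inf S + \<epsilon>" by simp
  define P where "P = H + \<epsilon>2 *\<^sub>R mat 1 - (\<mu> *\<^sub>R proj_perp e + \<kappa> *\<^sub>R proj_line e)"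
  have "0 \<le> z \<bullet> (P *v z)" for z
  proof -
    define s where "s = z \<bullet> e"
    have "z \<bullet> (P *v z) = Q z + \<epsilon> * (norm z)\<^sup>2 - \<kappa> * s\<^sup>2"
      unfolding P_def Q_def s_def \<epsilon>(2) power2_norm_eq_inner
      by (simp add: matrix_vector_mult_diff_rdistrib matrix_vector_mult_add_rdistrib
          flip: scaleR_matrix_vector_assoc)
        (simp add: proj_line_mult proj_perp_mult inner_diff_right inner_add_right
          power2_eq_square algebra_simps)
    moreover have "s\<^sup>2 \<le> (norm z)\<^sup>2"
      using Cauchy_Schwarz_ineq2[of z e] e by (simp add: s_def abs_le_square_iff[symmetric])
    then have "\<epsilon> * s\<^sup>2 \<le> \<epsilon> * (norm z)\<^sup>2" using \<epsilon> by simp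
    moreover have "s\<^sup>2 * Inf S \<le> Q z"
    proof (cases "s = 0")
      case True
      then show ?thesis using tangential[of z] \<epsilon> by (simp add: Q_def s_def)
    next
      case False
      define x where "x = (1 / s) *\<^sub>R z"
      have z: "z = s *\<^sub>R x" using False by (simp add: x_def)
      have "x \<bullet> e = 1" using False by (simp add: x_def s_def)
      then have "Inf S \<le> Q x" using bdd by (intro cInf_lower) (auto simp: S_def)
      moreover have "Q z = s\<^sup>2 * Q x"
        unfolding Q_def z
        by (simp add: matrix_vector_mult_scaleR power_mult_distrib power2_eq_square algebra_simps)
      ultimately show ?thesis by (simp add: mult_left_mono)
    qed
    moreover have "\<kappa> * s\<^sup>2 \<le> s\<^sup>2 * Inf S + \<epsilon> * s\<^sup>2"
      using mult_right_mono[OF \<kappa>, of "s\<^sup>2"] by (simp add: algebra_simps)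
    ultimately show ?thesis by linarith
  qed
  moreover have "P \<in> Sym2"
    unfolding P_def by (intro Sym2_add Sym2_diff Sym2_scaleR H) simp_all
  ultimately have "P \<in> psd" by (simp add: psd_def)
  moreover have "\<mu> *\<^sub>R proj_perp e + \<kappa> *\<^sub>R proj_line e \<in> F"
    unfolding \<kappa>_def by (rule slice[OF y(1)])
  ultimately have "\<mu> *\<^sub>R proj_perp e + \<kappa> *\<^sub>R proj_line e + P \<in> F"
    using F unfolding subequation_def by blast
  then show "H + \<epsilon>2 *\<^sub>R mat 1 \<in> F" by (simp add: P_def)
qed

section \<open>Hessians of radial functions\<close>

lemma C2_radial:
  fixes g :: "real \<Rightarrow> real" and x0 :: "real^'n"
  assumes g: "C2_near_real g (norm x0)" and x0: "x0 \<noteq> 0"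
  shows "C2_near (\<lambda>x. g (norm x)) x0"
    and "hessian (\<lambda>x. g (norm x)) x0 = (deriv g (norm x0) / norm x0) *\<^sub>R proj_perp (sgn x0)
      + deriv (deriv g) (norm x0) *\<^sub>R proj_line (sgn x0)"
proof -
  obtain U where U: "open U" "norm x0 \<in> U"
    and g1: "\<And>t. t \<in> U \<Longrightarrow> (g has_real_derivative deriv g t) (at t)"
    and g2: "\<And>t. t \<in> U \<Longrightarrow> (deriv g has_real_derivative deriv (deriv g) t) (at t)"
    and cont: "continuous_on U (deriv (deriv g))"
    using C2_near_real_E[OF g] by blast
  define V where "V = norm -` U - {0 :: real^'n}"
  define G where "G x = (deriv g (norm x) / norm x) *\<^sub>R x" for x :: "real^'n"
  define H where "H x = (deriv g (norm x) / norm x) *\<^sub>R proj_perp (sgn x)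
      + deriv (deriv g) (norm x) *\<^sub>R proj_line (sgn x)" for x :: "real^'n"
  have V: "open V" "x0 \<in> V"
    unfolding V_def using U x0 by (auto intro!: open_Diff open_vimage continuous_intros)
  have n: "(norm has_derivative (\<lambda>h. h \<bullet> sgn x)) (at x)" if "x \<in> V" for x :: "real^'n"
    using that has_derivative_norm by (auto simp: V_def)
  have f: "((\<lambda>x. g (norm x)) has_derivative (\<lambda>h. G x \<bullet> h)) (at x)" if "x \<in> V" for x
  proof -
    have "(g has_derivative (*) (deriv g (norm x))) (at (norm x))"
      using g1[of "norm x"] that by (simp add: V_def has_field_derivative_def)
    from has_derivative_compose[OF n[OF that] this] show ?thesis
      by (rule has_derivative_eq_rhs)
        (simp add: G_def sgn_div_norm inner_commute divide_inverse mult_ac)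
  qed
  have dG: "(G has_derivative (\<lambda>h. H x *v h)) (at x)" if "x \<in> V" for x
  proof -
    have r: "norm x > 0" and xU: "norm x \<in> U" using that by (auto simp: V_def)
    have "((\<lambda>t. deriv g t / t) has_derivative
        (*) ((deriv (deriv g) (norm x) * norm x - deriv g (norm x)) / (norm x * norm x))) (at (norm x))"
      using DERIV_divide[OF g2[OF xU] DERIV_ident] r by (simp add: has_field_derivative_def)
    from has_derivative_scaleR[OF has_derivative_compose[OF n[OF that] this] has_derivative_ident]
    show ?thesis unfolding G_def
    proof (rule has_derivative_eq_rhs)
      have x: "x = norm x *\<^sub>R sgn x" using r by (simp add: sgn_div_norm)
      show "(\<lambda>h. (deriv g (norm x) / norm x) *\<^sub>R h
          + ((deriv (deriv g) (norm x) * norm x - deriv g (norm x)) / (norm x * norm x) * (h \<bullet> sgn x)) *\<^sub>R x)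
        = (\<lambda>h. H x *v h)"
      proof
        fix h
        have "((deriv (deriv g) (norm x) * norm x - deriv g (norm x)) / (norm x * norm x) * (h \<bullet> sgn x)) *\<^sub>R x
          = ((deriv (deriv g) (norm x) - deriv g (norm x) / norm x) * (h \<bullet> sgn x)) *\<^sub>R sgn x"
          using r by (subst (4) x, simp add: field_simps)
        then show "(deriv g (norm x) / norm x) *\<^sub>R h
          + ((deriv (deriv g) (norm x) * norm x - deriv g (norm x)) / (norm x * norm x) * (h \<bullet> sgn x)) *\<^sub>R x
          = H x *v h"
          unfolding H_def matrix_vector_mult_add_rdistrib scaleR_matrix_vector_assoc[symmetric]
            proj_line_mult proj_perp_mult by (simp add: algebra_simps)
      qed
    qed
  qed
  have cH: "continuous_on V H"
  proof -
    have "continuous_on U (deriv g)"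
      using g2 by (meson DERIV_isCont continuous_at_imp_continuous_on)
    then have a: "continuous_on V (\<lambda>x. deriv g (norm x))"
      by (rule continuous_on_compose2) (auto simp: V_def intro!: continuous_intros)
    have b: "continuous_on V (\<lambda>x. deriv (deriv g) (norm x))"
      by (rule continuous_on_compose2[OF cont]) (auto simp: V_def intro!: continuous_intros)
    have "continuous_on V (\<lambda>x. \<chi> i j. sgn x $ i * sgn x $ j)"
      by (intro continuous_on_vec_lambda continuous_intros) (auto simp: V_def)
    moreover have "proj_line e = (\<chi> i j. e $ i * e $ j)" for e :: "real^'n"
      by (simp add: vec_eq_iff proj_line_component)
    ultimately have c: "continuous_on V (\<lambda>x. proj_line (sgn x))" by simp
    show ?thesis unfolding H_def proj_perp_def
      by (intro continuous_intros a b c) (auto simp: V_def)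
  qed
  show "C2_near (\<lambda>x. g (norm x)) x0" by (rule C2_nearI[OF V f dG cH])
  show "hessian (\<lambda>x. g (norm x)) x0 = (deriv g (norm x0) / norm x0) *\<^sub>R proj_perp (sgn x0)
      + deriv (deriv g) (norm x0) *\<^sub>R proj_line (sgn x0)"
    using C2_nearI(2)[OF V f dG cH] unfolding H_def .
qed

section \<open>Test functions restricted to curves\<close>

lemma C2_along_curve:
  fixes f :: "real^'n \<Rightarrow> real"
  assumes f: "C2_near f (c t0)"
    and c: "\<And>t. (c has_vector_derivative c' t) (at t)"
    and c': "\<And>t. (c' has_vector_derivative c'' t) (at t)"
    and c'': "continuous_on UNIV c''"
  shows "C2_near_real (\<lambda>t. f (c t)) t0"
    and "deriv (\<lambda>t. f (c t)) t0 = grad f (c t0) \<bullet> c' t0"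
    and "deriv (deriv (\<lambda>t. f (c t))) t0
      = (hessian f (c t0) *v c' t0) \<bullet> c' t0 + grad f (c t0) \<bullet> c'' t0"
proof -
  obtain U where U: "open U" "c t0 \<in> U"
    and f1: "\<And>x. x \<in> U \<Longrightarrow> (f has_derivative (\<lambda>h. grad f x \<bullet> h)) (at x)"
    and f2: "\<And>x. x \<in> U \<Longrightarrow> (grad f has_derivative (\<lambda>h. hessian f x *v h)) (at x)"
    and cont: "continuous_on U (hessian f)"
    using C2_nearE[OF f] by blast
  have cc: "continuous_on A c" "continuous_on A c'" for A
    using has_vector_derivative_continuous[OF c] has_vector_derivative_continuous[OF c']
    by (simp_all add: continuous_at_imp_continuous_on)
  have V: "open (c -` U)" "t0 \<in> c -` U"
    using U cc by (auto intro!: open_vimage)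
  have d1: "((\<lambda>t. f (c t)) has_real_derivative grad f (c t) \<bullet> c' t) (at t)" if "t \<in> c -` U" for t
    using has_real_derivative_along[where c = c, OF c f1] that by simp
  have d2: "((\<lambda>t. grad f (c t) \<bullet> c' t) has_real_derivative
      (hessian f (c t) *v c' t) \<bullet> c' t + grad f (c t) \<bullet> c'' t) (at t)" if "t \<in> c -` U" for t
    using has_real_derivative_inner[OF has_vector_derivative_along[where c = c, OF c f2] c'] that
    by simp
  have "continuous_on U (grad f)"
    using f2 by (meson has_derivative_continuous continuous_at_imp_continuous_on)
  then have 1: "continuous_on (c -` U) (\<lambda>t. grad f (c t))"
    by (rule continuous_on_compose2) (auto intro: cc)
  have 2: "continuous_on (c -` U) (\<lambda>t. hessian f (c t))"
    by (rule continuous_on_compose2[OF cont]) (auto intro: cc)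
  have 3: "continuous_on (c -` U) (\<lambda>t. hessian f (c t) *v c' t)"
    unfolding matrix_vector_mult_def
    by (intro continuous_on_vec_lambda continuous_intros 2 cc)
  have "continuous_on (c -` U) c''" using c'' continuous_on_subset by blast
  then have d3: "continuous_on (c -` U) (\<lambda>t. (hessian f (c t) *v c' t) \<bullet> c' t + grad f (c t) \<bullet> c'' t)"
    by (intro continuous_intros 1 3 cc)
  show "C2_near_real (\<lambda>t. f (c t)) t0"
    "deriv (\<lambda>t. f (c t)) t0 = grad f (c t0) \<bullet> c' t0"
    "deriv (deriv (\<lambda>t. f (c t))) t0
      = (hessian f (c t0) *v c' t0) \<bullet> c' t0 + grad f (c t0) \<bullet> c'' t0"
    by (rule C2_near_realI[OF V d1 d2 d3], assumption+)+
qed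

text \<open>If the second derivative were negative, the first derivative, which vanishes at \<open>t0\<close>, would be
  negative just to the right of \<open>t0\<close>, and \<open>g\<close> would decrease there.\<close>

lemma second_derivative_test:
  assumes g: "C2_near_real g t0" and min: "\<forall>\<^sub>F t in nhds t0. g t0 \<le> g t"
  shows "deriv g t0 = 0" and "0 \<le> deriv (deriv g) t0"
proof -
  obtain U where U: "open U" "t0 \<in> U"
    and g1: "\<And>t. t \<in> U \<Longrightarrow> (g has_real_derivative deriv g t) (at t)"
    and g2: "\<And>t. t \<in> U \<Longrightarrow> (deriv g has_real_derivative deriv (deriv g) t) (at t)"
    using C2_near_real_E[OF g] by metis
  have "\<forall>\<^sub>F t in nhds t0. t \<in> U" using U eventually_nhds_in_open by blast
  with min have "\<forall>\<^sub>F t in nhds t0. t \<in> U \<and> g t0 \<le> g t" by (rule eventually_elim2) simp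
  then obtain d where d: "0 < d" "\<And>t. dist t t0 < d \<Longrightarrow> t \<in> U \<and> g t0 \<le> g t"
    unfolding eventually_nhds_metric by blast
  show z: "deriv g t0 = 0"
    by (rule DERIV_local_min[OF g1[OF U(2)] d(1)])
      (use d(2) in \<open>auto simp: dist_real_def abs_minus_commute\<close>)
  show "0 \<le> deriv (deriv g) t0"
  proof (rule ccontr)
    assume "\<not> 0 \<le> deriv (deriv g) t0"
    then obtain r where r: "0 < r" "\<And>h. 0 < h \<Longrightarrow> h < r \<Longrightarrow> deriv g (t0 + h) < 0"
      using DERIV_neg_dec_right[OF g2[OF U(2)]] z by (metis not_le)
    define s where "s = min d r / 2"
    have s: "0 < s" "s < d" "s < r" using d r by (auto simp: s_def)
    have "\<exists>z. t0 < z \<and> z < t0 + s \<and> g (t0 + s) - g t0 = (t0 + s - t0) * deriv g z"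
      by (rule MVT2) (use s d(2) in \<open>auto intro!: g1 simp: dist_real_def\<close>)
    then obtain z where z: "t0 < z" "z < t0 + s" "g (t0 + s) - g t0 = s * deriv g z"
      by auto
    have "deriv g z < 0" using r(2)[of "z - t0"] z s by simp
    then have "g (t0 + s) < g t0" using z(3) s mult_pos_neg[of s "deriv g z"] by simp
    moreover have "g t0 \<le> g (t0 + s)" using d(2)[of "t0 + s"] s by (simp add: dist_real_def)
    ultimately show False by simp
  qed
qed

text \<open>One formula serves both uses. With \<open>p = 0\<close> it is a great circle on the sphere of radius \<open>t0\<close>;
  with \<open>p = 1\<close> it is a spiral whose point at time \<open>t \<ge> 0\<close> has norm \<open>t\<close>, if \<open>e\<close> and \<open>w\<close> are orthonormal. It passes through \<open>t0 *\<^sub>R e\<close> at time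
  \<open>t0\<close>, with angular speed \<open>s\<close> in the plane of \<open>e\<close> and \<open>w\<close>.\<close>

definition spiral :: "real^'n \<Rightarrow> real^'n \<Rightarrow> real \<Rightarrow> real \<Rightarrow> real \<Rightarrow> real \<Rightarrow> real^'n" where
  "spiral e w t0 p s t = (t0 + p * (t - t0)) *\<^sub>R (cos (s * (t - t0)) *\<^sub>R e + sin (s * (t - t0)) *\<^sub>R w)"

lemma spiral_start [simp]: "spiral e w t0 p s t0 = t0 *\<^sub>R e"
  by (simp add: spiral_def)

text \<open>The case \<open>s = 0\<close> is the ray, where \<open>w\<close> may be zero. It is needed for the velocity \<open>e\<close>, and it is
  the only case in dimension one, where no unit vector is orthogonal to \<open>e\<close>.\<close>

lemma norm_spiral:
  assumes e: "norm e = 1" and w: "w \<bullet> e = 0" and "norm w = 1 \<or> s = 0"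
  shows "norm (spiral e w t0 p s t) = \<bar>t0 + p * (t - t0)\<bar>"
proof -
  let ?\<theta> = "s * (t - t0)"
  have "(norm (cos ?\<theta> *\<^sub>R e + sin ?\<theta> *\<^sub>R w))\<^sup>2 = (cos ?\<theta>)\<^sup>2 + (sin ?\<theta>)\<^sup>2 * (w \<bullet> w)"
    unfolding power2_norm_eq_inner using e w
    by (simp add: inner_add_left inner_add_right inner_commute[of e w] norm_eq_1 power2_eq_square)
  also have "\<dots> = 1" using assms(3) by (auto simp: norm_eq_1)
  finally have "norm (cos ?\<theta> *\<^sub>R e + sin ?\<theta> *\<^sub>R w) = 1"
    by (simp add: power2_eq_1_iff) (smt (verit) norm_ge_zero)
  then show ?thesis by (simp add: spiral_def)
qed

lemma continuous_spiral: "isCont (spiral e w t0 p s) t"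
  unfolding spiral_def by (intro continuous_intros)

lemma C2_along_spiral:
  fixes f :: "real^'n \<Rightarrow> real"
  assumes f: "C2_near f (t0 *\<^sub>R e)"
  shows "C2_near_real (\<lambda>t. f (spiral e w t0 p s t)) t0"
    and "deriv (\<lambda>t. f (spiral e w t0 p s t)) t0 = grad f (t0 *\<^sub>R e) \<bullet> (p *\<^sub>R e + (t0 * s) *\<^sub>R w)"
    and "deriv (deriv (\<lambda>t. f (spiral e w t0 p s t))) t0
      = (hessian f (t0 *\<^sub>R e) *v (p *\<^sub>R e + (t0 * s) *\<^sub>R w)) \<bullet> (p *\<^sub>R e + (t0 * s) *\<^sub>R w)
        + grad f (t0 *\<^sub>R e) \<bullet> ((2 * p * s) *\<^sub>R w - (t0 * s\<^sup>2) *\<^sub>R e)"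
proof -
  define E where "E t = cos (s * (t - t0)) *\<^sub>R e + sin (s * (t - t0)) *\<^sub>R w" for t
  define W where "W t = cos (s * (t - t0)) *\<^sub>R w - sin (s * (t - t0)) *\<^sub>R e" for t
  have E: "(E has_vector_derivative s *\<^sub>R W t) (at t)" for t
    unfolding E_def W_def
    by (auto intro!: derivative_eq_intros simp: algebra_simps)
  have W: "(W has_vector_derivative - (s *\<^sub>R E t)) (at t)" for t
    unfolding E_def W_def
    by (auto intro!: derivative_eq_intros simp: algebra_simps)
  define c' where "c' t = p *\<^sub>R E t + ((t0 + p * (t - t0)) * s) *\<^sub>R W t" for t
  define c'' where "c'' t = (p * s) *\<^sub>R W t + (p * s) *\<^sub>R W t - ((t0 + p * (t - t0)) * s\<^sup>2) *\<^sub>R E t" for t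
  have s: "spiral e w t0 p s = (\<lambda>t. (t0 + p * (t - t0)) *\<^sub>R E t)"
    by (simp add: spiral_def E_def fun_eq_iff)
  have r: "((\<lambda>t. (t0 + p * (t - t0)) * k) has_real_derivative p * k) (at t)" for k t
    by (auto intro!: derivative_eq_intros)
  have c: "(spiral e w t0 p s has_vector_derivative c' t) (at t)" for t
    using has_vector_derivative_scaleR[OF r[of 1] E] unfolding s c'_def
    by (simp add: add.commute)
  have dc': "(c' has_vector_derivative c'' t) (at t)" for t
    unfolding c'_def
    by (rule has_vector_derivative_eq_rhs,
        rule has_vector_derivative_add[OF has_vector_derivative_scaleR[OF DERIV_const E]
          has_vector_derivative_scaleR[OF r W]])
      (simp add: c''_def power2_eq_square algebra_simps)
  have cont: "continuous_on UNIV c''"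
    unfolding c''_def E_def W_def by (intro continuous_intros)
  have two: "(2 * p * s) *\<^sub>R x = (p * s) *\<^sub>R x + (p * s) *\<^sub>R x" for x :: "real^'n"
    by (simp flip: scaleR_left_distrib)
  have "c' t0 = p *\<^sub>R e + (t0 * s) *\<^sub>R w" "c'' t0 = (2 * p * s) *\<^sub>R w - (t0 * s\<^sup>2) *\<^sub>R e"
    unfolding two by (simp_all add: c'_def c''_def E_def W_def)
  then show "C2_near_real (\<lambda>t. f (spiral e w t0 p s t)) t0"
    "deriv (\<lambda>t. f (spiral e w t0 p s t)) t0 = grad f (t0 *\<^sub>R e) \<bullet> (p *\<^sub>R e + (t0 * s) *\<^sub>R w)"
    "deriv (deriv (\<lambda>t. f (spiral e w t0 p s t))) t0
      = (hessian f (t0 *\<^sub>R e) *v (p *\<^sub>R e + (t0 * s) *\<^sub>R w)) \<bullet> (p *\<^sub>R e + (t0 * s) *\<^sub>R w)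
        + grad f (t0 *\<^sub>R e) \<bullet> ((2 * p * s) *\<^sub>R w - (t0 * s\<^sup>2) *\<^sub>R e)"
    using C2_along_curve[of f "spiral e w t0 p s" t0, OF _ c dc' cont] f by simp_all
qed

lemma eventually_spiral:
  assumes "\<forall>\<^sub>F x in nhds (t0 *\<^sub>R e). P x"
  shows "\<forall>\<^sub>F t in nhds t0. P (spiral e w t0 p s t)"
proof -
  have "filterlim (spiral e w t0 p s) (nhds (spiral e w t0 p s t0)) (nhds t0)"
    using continuous_spiral unfolding isCont_def tendsto_at_iff_tendsto_nhds .
  then have "filterlim (spiral e w t0 p s) (nhds (t0 *\<^sub>R e)) (nhds t0)" by simp
  then show ?thesis using assms by (rule eventually_compose_filterlim[rotated])
qed

text \<open>The second derivative along a great circle is not just the Hessian form: the circle's acceleration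
  \<open>- t0 e\<close> pairs with the gradient. This is where the term \<open>grad \<phi> \<bullet> e / t0\<close> comes from.\<close>

lemma C2_min_on_sphere:
  fixes \<phi> :: "real^'n \<Rightarrow> real"
  assumes \<phi>: "C2_near \<phi> (t0 *\<^sub>R e)" and e: "norm e = 1" and t0: "0 < t0"
    and min: "\<forall>\<^sub>F x in nhds (t0 *\<^sub>R e). norm x = t0 \<longrightarrow> \<phi> (t0 *\<^sub>R e) \<le> \<phi> x"
    and z: "z \<bullet> e = 0"
  shows "grad \<phi> (t0 *\<^sub>R e) \<bullet> z = 0"
    and "(grad \<phi> (t0 *\<^sub>R e) \<bullet> e / t0) * (norm z)\<^sup>2 \<le> z \<bullet> (hessian \<phi> (t0 *\<^sub>R e) *v z)"
proof -
  have "grad \<phi> (t0 *\<^sub>R e) \<bullet> z = 0 \<and>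
    (grad \<phi> (t0 *\<^sub>R e) \<bullet> e / t0) * (norm z)\<^sup>2 \<le> z \<bullet> (hessian \<phi> (t0 *\<^sub>R e) *v z)"
  proof (cases "z = 0")
    case False
    define w where "w = sgn z"
    have w: "norm w = 1" "w \<bullet> e = 0" and zw: "z = norm z *\<^sub>R w"
      using False z by (simp_all add: w_def norm_sgn sgn_div_norm)
    let ?g = "\<lambda>t. \<phi> (spiral e w t0 0 1 t)"
    have "norm (spiral e w t0 0 1 t) = t0" for t
      using norm_spiral[OF e w(2), of 1 t0 0 t] w t0 by simp
    then have "\<forall>\<^sub>F t in nhds t0. ?g t0 \<le> ?g t"
      using eventually_spiral[OF min, of w 0 1] by simp
    note test = second_derivative_test[OF C2_along_spiral(1)[OF \<phi>] this]
    have "t0 * (grad \<phi> (t0 *\<^sub>R e) \<bullet> w) = 0"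
      using test(1) C2_along_spiral(2)[OF \<phi>, of w 0 1] by simp
    then have 1: "grad \<phi> (t0 *\<^sub>R e) \<bullet> w = 0" using t0 by simp
    have "0 \<le> t0 * (t0 * (w \<bullet> (hessian \<phi> (t0 *\<^sub>R e) *v w)) - grad \<phi> (t0 *\<^sub>R e) \<bullet> e)"
      using test(2) C2_along_spiral(3)[OF \<phi>, of w 0 1]
      by (simp add: matrix_vector_mult_scaleR inner_commute[of w] algebra_simps)
    then have "grad \<phi> (t0 *\<^sub>R e) \<bullet> e / t0 \<le> w \<bullet> (hessian \<phi> (t0 *\<^sub>R e) *v w)"
      using t0 by (simp add: zero_le_mult_iff field_simps)
    from mult_right_mono[OF this, of "(norm z)\<^sup>2"]
    have "(grad \<phi> (t0 *\<^sub>R e) \<bullet> e / t0) * (norm z)\<^sup>2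
      \<le> (norm z *\<^sub>R w) \<bullet> (hessian \<phi> (t0 *\<^sub>R e) *v (norm z *\<^sub>R w))"
      by (simp add: matrix_vector_mult_scaleR power2_eq_square mult_ac)
    moreover have "grad \<phi> (t0 *\<^sub>R e) \<bullet> (norm z *\<^sub>R w) = 0" using 1 by simp
    ultimately show ?thesis unfolding zw[symmetric] by simp
  qed simp
  then show "grad \<phi> (t0 *\<^sub>R e) \<bullet> z = 0"
    "(grad \<phi> (t0 *\<^sub>R e) \<bullet> e / t0) * (norm z)\<^sup>2 \<le> z \<bullet> (hessian \<phi> (t0 *\<^sub>R e) *v z)"
    by blast+
qed

text \<open>The spiral satisfies \<open>norm (c t) = t\<close>, so \<open>\<psi> t \<le> \<phi> (c t)\<close> near \<open>t0\<close>. The tangential part of its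
  velocity contributes nothing to the first derivative because the gradient is radial. In the second
  derivative the only part of the acceleration that survives is the centripetal one; this accounts
  for the correction to the Hessian form, in which \<open>norm y\<^sup>2 - 1\<close> is the squared tangential speed.\<close>

lemma radial_test_function_from_spiral:
  fixes \<phi> :: "real^'n \<Rightarrow> real" and \<psi> :: "real \<Rightarrow> ereal"
  assumes \<phi>: "C2_near \<phi> (t0 *\<^sub>R e)" and e: "norm e = 1" and t0: "0 < t0"
    and above: "\<forall>\<^sub>F x in nhds (t0 *\<^sub>R e). \<psi> (norm x) \<le> ereal (\<phi> x)"
    and grad: "\<And>z. z \<bullet> e = 0 \<Longrightarrow> grad \<phi> (t0 *\<^sub>R e) \<bullet> z = 0"
    and y: "y \<bullet> e = 1"
  obtains g where "C2_near_real g t0" "\<forall>\<^sub>F t in nhds t0. \<psi> t \<le> ereal (g t)"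
    "g t0 = \<phi> (t0 *\<^sub>R e)" "deriv g t0 = grad \<phi> (t0 *\<^sub>R e) \<bullet> e"
    "deriv (deriv g) t0 = y \<bullet> (hessian \<phi> (t0 *\<^sub>R e) *v y)
      - (grad \<phi> (t0 *\<^sub>R e) \<bullet> e / t0) * ((norm y)\<^sup>2 - 1)"
proof -
  define \<tau> where "\<tau> = y - e"
  have ee: "e \<bullet> e = 1" using e by (simp add: norm_eq_1)
  have \<tau>: "\<tau> \<bullet> e = 0" "e \<bullet> \<tau> = 0"
    using y ee by (auto simp: \<tau>_def inner_diff_left inner_diff_right inner_commute)
  have n\<tau>: "(norm \<tau>)\<^sup>2 = (norm y)\<^sup>2 - 1"
    using y ee by (simp add: \<tau>_def power2_norm_eq_inner inner_diff_left inner_diff_right inner_commute)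
  \<comment> \<open>Chosen so that the spiral starts with velocity \<open>e + t0 s w = y\<close>; if \<open>y = e\<close>, it is the ray.\<close>
  define w where "w = sgn \<tau>"
  define s where "s = norm \<tau> / t0"
  have w: "w \<bullet> e = 0" "norm w = 1 \<or> s = 0"
    using \<tau>(1) by (simp add: w_def sgn_div_norm) (simp add: w_def s_def norm_sgn)
  have tsw: "(t0 * s) *\<^sub>R w = \<tau>"
    using t0 by (cases "\<tau> = 0") (simp_all add: w_def s_def sgn_div_norm)
  have ye: "y = 1 *\<^sub>R e + (t0 * s) *\<^sub>R w" by (simp add: tsw \<tau>_def)
  define g where "g t = \<phi> (spiral e w t0 1 s t)" for t
  note C2 = C2_along_spiral[OF \<phi>, of w 1 s, folded ye, folded g_def]
  show ?thesis
  proof (rule that[OF C2(1)])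
    have "\<forall>\<^sub>F t in nhds t0. 0 < t"
      using t0 eventually_nhds_in_open[of "{0<..}" t0] by simp
    with eventually_spiral[OF above, of w 1 s] show "\<forall>\<^sub>F t in nhds t0. \<psi> t \<le> ereal (g t)"
    proof eventually_elim
      case (elim t)
      then show ?case using norm_spiral[OF e w, of t0 1 t] by (simp add: g_def)
    qed
    show "g t0 = \<phi> (t0 *\<^sub>R e)" by (simp add: g_def)
    show "deriv g t0 = grad \<phi> (t0 *\<^sub>R e) \<bullet> e"
      unfolding C2(2) using grad[OF \<tau>(1)] by (simp add: \<tau>_def inner_diff_right)
    have "t0 * s\<^sup>2 = (norm \<tau>)\<^sup>2 / t0" using t0 by (simp add: s_def power2_eq_square)
    then show "deriv (deriv g) t0 = y \<bullet> (hessian \<phi> (t0 *\<^sub>R e) *v y)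
        - (grad \<phi> (t0 *\<^sub>R e) \<bullet> e / t0) * ((norm y)\<^sup>2 - 1)"
      unfolding C2(3) using grad[OF w(1)]
      by (simp add: inner_diff_right inner_commute[of y] flip: n\<tau>)
  qed
qed

section \<open>Radial subharmonicity\<close>

lemma usc_on_radial:
  fixes \<psi> :: "real \<Rightarrow> ereal"
  assumes "usc_on I \<psi>"
  shows "usc_on {x :: 'a::real_normed_vector. norm x \<in> I} (\<lambda>x. \<psi> (norm x))"
  unfolding usc_on_def
proof (intro conjI ballI allI impI)
  fix x :: 'a and c assume x: "x \<in> {x. norm x \<in> I}"
  then show "\<psi> (norm x) < \<infinity>" using assms by (simp add: usc_on_def)
  assume c: "\<psi> (norm x) < c"
  then have "\<forall>\<^sub>F t in at (norm x) within I. \<psi> t < c"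
    using assms x by (simp add: usc_on_def)
  then obtain d where d: "0 < d" "\<And>t. t \<in> I \<Longrightarrow> t \<noteq> norm x \<Longrightarrow> dist t (norm x) < d \<Longrightarrow> \<psi> t < c"
    unfolding eventually_at by blast
  have "\<psi> (norm y) < c" if "y \<in> {x. norm x \<in> I}" "dist y x < d" for y :: 'a
  proof (cases "norm y = norm x")
    case False
    have "dist (norm y) (norm x) \<le> dist y x"
      using norm_triangle_ineq3[of y x] by (simp add: dist_norm)
    then show ?thesis using d(2)[of "norm y"] that False by simp
  qed (use c in simp)
  then show "\<forall>\<^sub>F y in at x within {x. norm x \<in> I}. \<psi> (norm y) < c"
    unfolding eventually_at using d(1) by blast
qed

lemma subharmonic_radial_imp_radial_subharmonic:
  fixes F :: "(real^'n^'n) set"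
  assumes sub: "subharmonic F {x. norm x \<in> I} (\<lambda>x. \<psi> (norm x))"
    and I: "open I" "I \<subseteq> {0<..}" and usc: "usc_on I \<psi>"
  shows "radial_subharmonic F I \<psi>"
  unfolding radial_subharmonic_def
proof (intro conjI ballI allI impI I(1) usc)
  fix t0 g assume t0: "t0 \<in> I"
    and g: "C2_near_real g t0 \<and> (\<forall>\<^sub>F t in nhds t0. \<psi> t \<le> ereal (g t)) \<and> \<psi> t0 = ereal (g t0)"
  have pos: "0 < t0" using t0 I by auto
  have "(deriv g t0 / t0) *\<^sub>R proj_perp e + deriv (deriv g) t0 *\<^sub>R proj_line e \<in> F"
    if e: "norm e = 1" for e :: "real^'n"
  proof -
    let ?x = "t0 *\<^sub>R e" and ?u = "\<lambda>x :: real^'n. g (norm x)"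
    have n: "norm ?x = t0" and s: "sgn ?x = e" and nz: "?x \<noteq> 0"
      using e pos by (auto simp: sgn_div_norm)
    have g': "C2_near_real g (norm ?x)" using g n by simp
    have "filterlim norm (nhds (norm ?x)) (nhds ?x)" by (rule tendsto_norm[OF filterlim_ident])
    moreover have "\<forall>\<^sub>F t in nhds (norm ?x). \<psi> t \<le> ereal (g t)"
      unfolding n using g by simp
    ultimately have above: "\<forall>\<^sub>F x in nhds ?x. \<psi> (norm x) \<le> ereal (?u x)"
      by (rule eventually_compose_filterlim[rotated])
    have touch: "\<psi> (norm ?x) = ereal (?u ?x)" unfolding n using g by simp
    have "?x \<in> {x. norm x \<in> I}" using n t0 by simp
    then have "hessian ?u ?x \<in> F"
      using sub C2_radial(1)[OF g' nz] above touch unfolding subharmonic_def by blast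
    then show ?thesis unfolding C2_radial(2)[OF g' nz] n s .
  qed
  then show "(deriv g t0, deriv (deriv g) t0) \<in> radial_subequation F t0"
    by (simp add: radial_subequation_def)
qed

lemma radial_subharmonic_imp_subharmonic_radial:
  fixes F :: "(real^'n^'n) set"
  assumes F: "subequation F" and rad: "radial_subharmonic F I \<psi>" and I: "I \<subseteq> {0<..}"
  shows "subharmonic F {x. norm x \<in> I} (\<lambda>x. \<psi> (norm x))"
  unfolding subharmonic_def
proof (intro conjI ballI allI impI)
  have "open (norm -` I :: (real^'n) set)"
    using rad by (auto simp: radial_subharmonic_def intro!: open_vimage continuous_intros)
  then show "open {x :: real^'n. norm x \<in> I}" by (simp add: vimage_def)
  show "usc_on {x :: real^'n. norm x \<in> I} (\<lambda>x. \<psi> (norm x))"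
    using rad by (intro usc_on_radial) (simp add: radial_subharmonic_def)
next
  fix x0 :: "real^'n" and \<phi> assume x0: "x0 \<in> {x. norm x \<in> I}"
    and test: "C2_near \<phi> x0 \<and> (\<forall>\<^sub>F x in nhds x0. \<psi> (norm x) \<le> ereal (\<phi> x)) \<and> \<psi> (norm x0) = ereal (\<phi> x0)"
  define t0 where "t0 = norm x0"
  define e where "e = sgn x0"
  have t0: "0 < t0" "t0 \<in> I" using x0 I by (auto simp: t0_def)
  then have e: "norm e = 1" and x0e: "x0 = t0 *\<^sub>R e"
    by (auto simp: e_def t0_def norm_sgn sgn_div_norm)
  have \<phi>: "C2_near \<phi> (t0 *\<^sub>R e)" and above: "\<forall>\<^sub>F x in nhds (t0 *\<^sub>R e). \<psi> (norm x) \<le> ereal (\<phi> x)"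
    and touch: "\<psi> t0 = ereal (\<phi> (t0 *\<^sub>R e))"
    using test unfolding x0e[symmetric] by (auto simp: t0_def)
  have "\<forall>\<^sub>F x in nhds (t0 *\<^sub>R e). norm x = t0 \<longrightarrow> \<phi> (t0 *\<^sub>R e) \<le> \<phi> x"
    using above by eventually_elim (use touch in auto)
  note sphere = C2_min_on_sphere[OF \<phi> e t0(1) this]
  let ?H = "hessian \<phi> (t0 *\<^sub>R e)" and ?l = "grad \<phi> (t0 *\<^sub>R e) \<bullet> e"
  have "?H \<in> F"
  proof (rule in_subequation_if_slices[OF F hessian_in_Sym2[OF \<phi>] e sphere(2)])
    fix y assume y: "y \<bullet> e = 1"
    obtain g where gtest: "C2_near_real g t0" "\<forall>\<^sub>F t in nhds t0. \<psi> t \<le> ereal (g t)"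
      "g t0 = \<phi> (t0 *\<^sub>R e)" and g: "deriv g t0 = ?l"
      "deriv (deriv g) t0 = y \<bullet> (?H *v y) - (?l / t0) * ((norm y)\<^sup>2 - 1)"
      by (rule radial_test_function_from_spiral[OF \<phi> e t0(1) above sphere(1) y])
    have "\<psi> t0 = ereal (g t0)" using touch gtest(3) by simp
    then have "(deriv g t0, deriv (deriv g) t0) \<in> radial_subequation F t0"
      using rad t0(2) gtest(1,2) unfolding radial_subharmonic_def by blast
    then show "(?l / t0) *\<^sub>R proj_perp e
        + (y \<bullet> (?H *v y) - (?l / t0) * ((norm y)\<^sup>2 - 1)) *\<^sub>R proj_line e \<in> F"
      using e unfolding g radial_subequation_def by blast
  qed
  then show "hessian \<phi> x0 \<in> F" using x0e by simp
qed

theorem theorem2p4: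
  fixes F :: "(real^'n^'n) set" and a b :: ereal and \<psi> :: "real \<Rightarrow> ereal"
  assumes "subequation F"
    and "einterval a b \<subseteq> {0<..}"
    and "usc_on (einterval a b) \<psi>"
  shows "subharmonic F {x :: real^'n. a < ereal (norm x) \<and> ereal (norm x) < b} (\<lambda>x. \<psi> (norm x))
     \<longleftrightarrow> radial_subharmonic F (einterval a b) \<psi>"
proof -
  have "{x :: real^'n. a < ereal (norm x) \<and> ereal (norm x) < b} = {x. norm x \<in> einterval a b}"
    by (simp add: einterval_iff)
  moreover have "subharmonic F {x :: real^'n. norm x \<in> einterval a b} (\<lambda>x. \<psi> (norm x))
      \<longleftrightarrow> radial_subharmonic F (einterval a b) \<psi>"
  proof
    assume "subharmonic F {x :: real^'n. norm x \<in> einterval a b} (\<lambda>x. \<psi> (norm x))"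
    then show "radial_subharmonic F (einterval a b) \<psi>"
      by (rule subharmonic_radial_imp_radial_subharmonic[OF _ open_einterval assms(2,3)])
  next
    assume "radial_subharmonic F (einterval a b) \<psi>"
    then show "subharmonic F {x :: real^'n. norm x \<in> einterval a b} (\<lambda>x. \<psi> (norm x))"
      by (rule radial_subharmonic_imp_subharmonic_radial[OF assms(1) _ assms(2)])
  qed
  ultimately show ?thesis by simp
qed

end
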